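(* Let $f:X\to X$ be a continuous map of a compact metric space. If every point $x\in X$ is statistically unstable (for $f$), then the set of non-statistical points of $f$ is a Baire generic subset of $X$.
   Context: $\mathcal{M}_1(\cdot)$ denotes the space of Borel probability measures with the Wasserstein distance $d_w(\nu_1,\nu_2)=\inf_\zeta\int d(x,y)\,d\zeta$ (infimum over couplings), inducing the weak-$*$ topology. Empirical measures: $e_n^f(x)=\frac1n\sum_{i=0}^{n-1}\delta_{f^i(x)}$. A point $x$ is non-statistical for $f$ if $\{e_n^f(x)\}_n$ does not converge. Baire generic means containing a countable intersection of open dense subsets. Statistical instability of points: let $\hat X=\{\hat x\}\sqcup X$, where $\hat x$ is an added point at distance $1$ from every point of $X$ (after rescaling the metric of $X$, if necessary, so that its diameter is at most $2$). For $x\in X$ define $F_x:\hat X\to\hat X$ by $F_x(\hat x)=x$ and $F_x|_X=f$. Let $\Lambda=\{F_x\}_{x\in X}$ with the topology transported from $X$ via $x\mapsto F_x$, and take the reference measure $\mu=\delta_{\hat x}$ on $\hat X$. The point $x\in X$ is statistically unstable if the map $F_x$ is statistically unstable in $\Lambda$, i.e. $\lim_{N\to\infty}\limsup_{h,g\to F_x;\ h,g\in\Lambda}\int_{\hat X}\sup_{n,m\ge N}d_w(e_n^h(y),e_m^g(y))\,d\mu(y)>0$, where $\limsup_{h,g\to F_x}$ means the infimum over neighborhoods $V$ of $F_x$ in $\Lambda$ of the supremum over $h,g\in V$. *)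

theory Defs
  imports "HOL-Probability.Probability"
begin

section \<open>Borel probability measures with the Wasserstein distance\<close>

definition borel_prob_measures :: "'a::topological_space measure set" where
  "borel_prob_measures = {\<nu>. prob_space \<nu> \<and> sets \<nu> = sets borel}"

definition couplings ::
  "'a::topological_space measure \<Rightarrow> 'a measure \<Rightarrow> ('a \<times> 'a) measure set" where
  "couplings \<nu>1 \<nu>2 =
     {\<zeta>\<in>borel_prob_measures. distr \<zeta> borel fst = \<nu>1 \<and> distr \<zeta> borel snd = \<nu>2}"

definition wasserstein :: "'a::metric_space measure \<Rightarrow> 'a measure \<Rightarrow> real" where
  "wasserstein \<nu>1 \<nu>2 = (INF \<zeta>\<in>couplings \<nu>1 \<nu>2. \<integral>p. dist (fst p) (snd p) \<partial>\<zeta>)"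

section \<open>Empirical measures and non-statistical points\<close>

text \<open>
  The set function below is countably additive, so \<^const>\<open>measure_of\<close> does not degenerate to the
  null measure; see the lemma \<open>emeasure_empirical_measure\<close>.  For \<open>n = 0\<close> the
  value is the null measure, a junk value that plays no role in limits as \<open>n\<close> tends to infinity.
\<close>

definition empirical_measure ::
  "('a::topological_space \<Rightarrow> 'a) \<Rightarrow> nat \<Rightarrow> 'a \<Rightarrow> 'a measure" where
  "empirical_measure f n x =
     measure_of UNIV (sets borel) (\<lambda>A. (\<Sum>i<n. emeasure (return borel ((f ^^ i) x)) A) / of_nat n)"

lemma sets_empirical_measure [simp]: "sets (empirical_measure f n x) = sets borel"
  unfolding empirical_measure_def
  by (metis sets.sets_measure_of_eq space_borel)

lemma emeasure_empirical_measure: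
  assumes "A \<in> sets borel"
  shows "emeasure (empirical_measure f n x) A =
    (\<Sum>i<n. emeasure (return borel ((f ^^ i) x)) A) / of_nat n"
  unfolding empirical_measure_def
proof (rule emeasure_measure_of_sigma)
  show "sigma_algebra UNIV (sets borel)"
    by (metis sets.sigma_algebra_axioms space_borel)
  show "positive (sets borel)
    (\<lambda>A. (\<Sum>i<n. emeasure (return borel ((f ^^ i) x)) A) / of_nat n)"
    by (simp add: positive_def)
  show "countably_additive (sets borel)
    (\<lambda>A. (\<Sum>i<n. emeasure (return borel ((f ^^ i) x)) A) / of_nat n)"
  proof (rule countably_additiveI)
    fix B :: "nat \<Rightarrow> 'a set"
    assume B: "range B \<subseteq> sets borel" "disjoint_family B"
    have "(\<Sum>k. (\<Sum>i<n. emeasure (return borel ((f ^^ i) x)) (B k)) / of_nat n) =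
      (\<Sum>i<n. \<Sum>k. emeasure (return borel ((f ^^ i) x)) (B k)) / of_nat n"
      by (simp add: divide_ennreal_def suminf_sum)
    also have "\<dots> = (\<Sum>i<n. emeasure (return borel ((f ^^ i) x)) (\<Union>(range B))) / of_nat n"
      using B by (intro arg_cong2[of _ _ _ _ "(/)"] sum.cong refl suminf_emeasure) auto
    finally show "(\<Sum>k. (\<Sum>i<n. emeasure (return borel ((f ^^ i) x)) (B k)) / of_nat n) =
      (\<Sum>i<n. emeasure (return borel ((f ^^ i) x)) (\<Union>(range B))) / of_nat n" .
  qed
qed (fact assms)

lemma empirical_measure_in_borel_prob_measures:
  assumes "n > 0"
  shows "empirical_measure f n x \<in> borel_prob_measures"
proof -
  have "emeasure (empirical_measure f n x) UNIV = 1"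
    using assms by (simp add: emeasure_empirical_measure ennreal_divide_self ennreal_of_nat_eq_real_of_nat)
  then have "prob_space (empirical_measure f n x)"
    by (metis prob_spaceI sets_empirical_measure sets_eq_imp_space_eq space_borel)
  then show ?thesis
    by (simp add: borel_prob_measures_def)
qed

definition non_statistical :: "('a::metric_space \<Rightarrow> 'a) \<Rightarrow> 'a \<Rightarrow> bool" where
  "non_statistical f x \<longleftrightarrow>
     \<not> (\<exists>\<nu>\<in>borel_prob_measures. (\<lambda>n. wasserstein (empirical_measure f n x) \<nu>) \<longlonglongrightarrow> 0)"

definition baire_generic :: "'a::topological_space set \<Rightarrow> bool" where
  "baire_generic S \<longleftrightarrow>
     (\<exists>\<G>. countable \<G> \<and> (\<forall>U\<in>\<G>. open U \<and> closure U = UNIV) \<and> \<Inter>\<G> \<subseteq> S)"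

section \<open>Statistical instability of a map within a family of maps\<close>

text \<open>
  A family of maps is represented by a topology \<open>\<L>\<close>, whose \<^const>\<open>topspace\<close> is the underlying set
  of maps.  The infimum over open neighbourhoods equals the one over all neighbourhoods, because
  the supremum is monotone in \<open>V\<close>.
\<close>

definition instability_at ::
  "'b::metric_space measure \<Rightarrow> ('b \<Rightarrow> 'b) topology \<Rightarrow> ('b \<Rightarrow> 'b) \<Rightarrow> nat \<Rightarrow> ennreal" where
  "instability_at \<mu> \<L> F N =
     (INF V\<in>{V. openin \<L> V \<and> F \<in> V}. SUP h\<in>V. SUP g\<in>V.
        \<integral>\<^sup>+y. (SUP n\<in>{N..}. SUP m\<in>{N..}.
          ennreal (wasserstein (empirical_measure h n y) (empirical_measure g m y))) \<partial>\<mu>)"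

text \<open>Monotonicity in \<open>N\<close> guarantees that the limit in the definition of instability exists.\<close>

lemma decseq_instability_at: "decseq (instability_at \<mu> \<L> F)"
  unfolding decseq_def instability_at_def
  by (intro allI impI INF_mono' SUP_subset_mono nn_integral_mono SUP_subset_mono) auto

lemma convergent_instability_at: "convergent (instability_at \<mu> \<L> F)"
  using decseq_instability_at LIMSEQ_INF convergentI by blast

definition statistically_unstable ::
  "'b::metric_space measure \<Rightarrow> ('b \<Rightarrow> 'b) topology \<Rightarrow> ('b \<Rightarrow> 'b) \<Rightarrow> bool" where
  "statistically_unstable \<mu> \<L> F \<longleftrightarrow> lim (instability_at \<mu> \<L> F) > 0"

section \<open>A compact metric space with an added point\<close>

class compact_metric_space = metric_space +
  assumes compact_UNIV: "compact (UNIV :: 'a set)"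

definition metric_scale :: "'a::metric_space itself \<Rightarrow> real" where
  "metric_scale _ =
     (if diameter (UNIV :: 'a set) \<le> 2 then 1 else 2 / diameter (UNIV :: 'a set))"

lemma metric_scale_pos: "metric_scale TYPE('a::metric_space) > 0"
  by (simp add: metric_scale_def)

lemma metric_scale_dist_le:
  "metric_scale TYPE('a::compact_metric_space) * dist (x::'a) y \<le> 2"
proof -
  have "dist x y \<le> diameter (UNIV :: 'a set)"
    using compact_imp_bounded[OF compact_UNIV] by (intro diameter_bounded_bound) auto
  then show ?thesis
    by (auto simp: metric_scale_def field_simps)
qed

datatype 'a pointed = Added | Orig 'a

instantiation pointed :: (compact_metric_space) metric_space
begin

fun dist_pointed :: "'a pointed \<Rightarrow> 'a pointed \<Rightarrow> real" where
  "dist_pointed Added Added = 0"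
| "dist_pointed Added (Orig y) = 1"
| "dist_pointed (Orig x) Added = 1"
| "dist_pointed (Orig x) (Orig y) = metric_scale TYPE('a) * dist x y"

definition uniformity_pointed :: "('a pointed \<times> 'a pointed) filter" where
  "uniformity_pointed = (INF e\<in>{0<..}. principal {(p, q). dist p q < e})"

definition open_pointed :: "'a pointed set \<Rightarrow> bool" where
  "open_pointed U \<longleftrightarrow> (\<forall>p\<in>U. \<forall>\<^sub>F (p', q) in uniformity. p' = p \<longrightarrow> q \<in> U)"

instance
proof
  fix p q r :: "'a pointed"
  have pos: "metric_scale TYPE('a) > 0"
    by (rule metric_scale_pos)
  show "dist p q = 0 \<longleftrightarrow> p = q"
    using pos by (cases p; cases q) auto
  show "dist p q \<le> dist p r + dist q r"
  proof (cases p; cases q; cases r)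
    fix x y z assume eq: "p = Orig x" "q = Orig y" "r = Orig z"
    have "metric_scale TYPE('a) * dist x y \<le> metric_scale TYPE('a) * (dist x z + dist y z)"
      using pos by (intro mult_left_mono dist_triangle2) auto
    then show ?thesis
      by (simp add: eq algebra_simps)
  qed (use pos metric_scale_dist_le in auto)
qed (fact uniformity_pointed_def open_pointed_def)+

end

section \<open>Statistical instability of points\<close>

fun pointed_map :: "('a \<Rightarrow> 'a) \<Rightarrow> 'a \<Rightarrow> 'a pointed \<Rightarrow> 'a pointed" where
  "pointed_map f x Added = Orig x"
| "pointed_map f x (Orig y) = Orig (f y)"

lemma inj_pointed_map: "inj (pointed_map f)"
  by (metis injI pointed.inject pointed_map.simps(1))

definition pointed_map_topology ::
  "('a::topological_space \<Rightarrow> 'a) \<Rightarrow> ('a pointed \<Rightarrow> 'a pointed) topology" where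
  "pointed_map_topology f = topology (\<lambda>V. \<exists>U. open U \<and> V = pointed_map f ` U)"

lemma openin_pointed_map_topology:
  "openin (pointed_map_topology f) V \<longleftrightarrow> (\<exists>U. open U \<and> V = pointed_map f ` U)"
proof -
  have "istopology (\<lambda>V. \<exists>U. open U \<and> V = pointed_map f ` U)"
    unfolding istopology_def
  proof (intro conjI allI impI)
    fix S T
    assume "\<exists>U. open U \<and> S = pointed_map f ` U" "\<exists>U. open U \<and> T = pointed_map f ` U"
    then show "\<exists>U. open U \<and> S \<inter> T = pointed_map f ` U"
      by (metis image_Int inj_pointed_map open_Int)
  next
    fix \<K>
    assume "\<forall>K\<in>\<K>. \<exists>U. open U \<and> K = pointed_map f ` U"
    then obtain u where u: "\<And>K. K \<in> \<K> \<Longrightarrow> open (u K) \<and> K = pointed_map f ` u K"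
      by metis
    then have "open (\<Union>(u ` \<K>))" and "\<Union>\<K> = pointed_map f ` \<Union>(u ` \<K>)"
      by blast+
    then show "\<exists>U. open U \<and> \<Union>\<K> = pointed_map f ` U"
      by blast
  qed
  then show ?thesis
    by (simp add: pointed_map_topology_def topology_inverse' fun_eq_iff)
qed

lemma topspace_pointed_map_topology: "topspace (pointed_map_topology f) = range (pointed_map f)"
  unfolding topspace_def openin_pointed_map_topology by blast

definition statistically_unstable_point ::
  "('a::compact_metric_space \<Rightarrow> 'a) \<Rightarrow> 'a \<Rightarrow> bool" where
  "statistically_unstable_point f x \<longleftrightarrow>
     statistically_unstable (return borel Added) (pointed_map_topology f) (pointed_map f x)"

end

theory Submission
  imports Defs
begin

text \<open>
  Statistical behaviour is tested by Birkhoff averages of continuous functions.  If \<open>x\<close> is statistical,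
  its empirical measures converge and with them the Birkhoff averages of every continuous
  function (\<open>birkhoff_average_tendsto_integral\<close>); so it is enough to find, at a generic point, one
  continuous function whose averages diverge.

  Instability of a point \<open>x\<close> says that arbitrarily near \<open>x\<close> and arbitrarily late there are two empirical
  measures whose Wasserstein distance exceeds some \<open>\<epsilon>\<close> that depends only on \<open>x\<close>.  By
  \<open>finitely_many_functions_control_wasserstein\<close>, a distance larger than \<open>\<epsilon>\<close> is witnessed by one of finitely
  many continuous functions, so the averages of one of them oscillate by a fixed amount, in every
  neighbourhood of \<open>x\<close> and at arbitrarily late times.  Letting \<open>\<epsilon>\<close> run through the numbers
  \<open>1 / (l + 1)\<close> leaves countably many test functions altogether.

  The topological core is \<open>oscillation_imp_generic_divergence\<close>. Consider the points
  whose own averages vary, after time \<open>N\<close>, by more than a fixed amount below a quarter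
  of the oscillation. If \<open>x\<close> were not a limit of such points, all averages near
  \<open>x\<close> after time \<open>N\<close> would be close to the one at time \<open>N\<close>,
  which is continuous, and there would be no oscillation at \<open>x\<close>. Hence these open sets
  accumulate at \<open>x\<close>, and a generic point that is a limit of all of them belongs to all
  of them.

  Working with averages of test functions avoids both the triangle inequality for the Wasserstein
  distance, which would need couplings to be glued, and Kantorovich duality.  Only a direct
  construction of transport plans between finite distributions is needed
  (\<open>transport_plan_from_blocks\<close>).
\<close>

section \<open>Generic divergence from oscillation\<close>

lemma baire_generic_mono:
  assumes "baire_generic A" "A \<subseteq> B"
  shows "baire_generic B"
proof -
  obtain \<G> where "countable \<G>" "\<forall>U\<in>\<G>. open U \<and> closure U = UNIV" "\<Inter>\<G> \<subseteq> A"
    using assms(1) unfolding baire_generic_def by auto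
  moreover from this have "\<Inter>\<G> \<subseteq> B"
    using assms(2) by auto
  ultimately show ?thesis
    unfolding baire_generic_def by auto
qed

text \<open>
  The set \<open>G\<close> of points at which \<open>T i\<close> still varies by more than a fixed amount after time \<open>N\<close> is open.
  If \<open>x\<close> were outside its closure, then near \<open>x\<close> every late value \<open>T i n y\<close> would be close to \<open>T i N y\<close>,
  hence by continuity of the single function \<open>T i N\<close> close to the constant \<open>T i N x\<close>,
  which contradicts the oscillation at \<open>x\<close>.  So every point lies, for some index and all \<open>N\<close>, in
  the closure of \<open>G\<close>, and the dense open sets \<open>G \<union> - closure G\<close> force generic points into
  \<open>G\<close> itself.
\<close>

lemma oscillation_imp_generic_divergence:
  fixes T :: "'i \<Rightarrow> nat \<Rightarrow> 'a::topological_space \<Rightarrow> 'b::metric_space"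
  assumes S: "countable S"
    and cont: "\<And>i n. i \<in> S \<Longrightarrow> continuous_on UNIV (T i n)"
    and osc: "\<And>x. \<exists>i\<in>S. \<exists>\<delta>>0. \<forall>N V. open V \<longrightarrow> x \<in> V \<longrightarrow>
                (\<exists>u\<in>V. \<exists>v\<in>V. \<exists>n\<ge>N. \<exists>m\<ge>N. \<delta> \<le> dist (T i n u) (T i m v))"
  shows "baire_generic {x. \<exists>i\<in>S. \<not> convergent (\<lambda>n. T i n x)}"
proof -
  define G where "G i k N =
    (\<Union>n\<in>{N..}. \<Union>m\<in>{N..}. {x. inverse (of_nat (Suc k)) < dist (T i n x) (T i m x)})" for i k N
  have openG: "open (G i k N)" if "i \<in> S" for i k N
    unfolding G_def
    by (intro open_UN ballI open_Collect_less continuous_intros cont that)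
  define \<G> where "\<G> = (\<lambda>(i, k, N). G i k N \<union> - closure (G i k N)) ` (S \<times> UNIV)"
  have "countable \<G>"
    unfolding \<G>_def using S by (intro countable_image countable_SIGMA) auto
  moreover have "open U \<and> closure U = UNIV" if UG: "U \<in> \<G>" for U
  proof -
    obtain i k N where "i \<in> S" and U: "U = G i k N \<union> - closure (G i k N)"
      using UG unfolding \<G>_def by auto
    have "open U"
      unfolding U using openG[OF \<open>i \<in> S\<close>] by auto
    moreover have "closure U = UNIV"
      unfolding U closure_Un using closure_subset[of "- closure (G i k N)"] by auto
    ultimately show ?thesis ..
  qed
  moreover have "\<Inter>\<G> \<subseteq> {x. \<exists>i\<in>S. \<not> convergent (\<lambda>n. T i n x)}"
  proof
    fix x assume x: "x \<in> \<Inter>\<G>"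
    obtain i \<delta> where i: "i \<in> S" and "\<delta> > 0"
      and osc: "\<And>N V. open V \<Longrightarrow> x \<in> V \<Longrightarrow>
        \<exists>u\<in>V. \<exists>v\<in>V. \<exists>n\<ge>N. \<exists>m\<ge>N. \<delta> \<le> dist (T i n u) (T i m v)"
      using osc[of x] by metis
    \<comment> \<open>Going from \<open>T i n u\<close> to \<open>T i m v\<close> takes four steps, through \<open>T i N u\<close>, \<open>T i N x\<close> and \<open>T i N v\<close>.\<close>
    obtain k where k: "inverse (real (Suc k)) < \<delta> / 4"
      using reals_Archimedean[of "\<delta> / 4"] \<open>\<delta> > 0\<close> by auto
    define c where "c = inverse (real (Suc k))"
    have "c > 0" by (simp add: c_def)
    have "x \<in> closure (G i k N)" for N
    proof (rule ccontr)
      assume nx: "x \<notin> closure (G i k N)"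
      define V where "V = - closure (G i k N) \<inter> {y. dist (T i N y) (T i N x) < c}"
      have "open V"
        unfolding V_def
        by (intro open_Int open_Compl closed_closure open_Collect_less continuous_intros cont i)
      moreover have "x \<in> V"
        using nx \<open>c > 0\<close> by (simp add: V_def)
      ultimately obtain u v n m where uv: "u \<in> V" "v \<in> V" and nm: "n \<ge> N" "m \<ge> N"
        and *: "\<delta> \<le> dist (T i n u) (T i m v)"
        using osc by metis
      have near: "dist (T i l y) (T i N x) < 2 * c" if "y \<in> V" "l \<ge> N" for l y
      proof -
        have "y \<notin> G i k N"
          using that closure_subset by (auto simp: V_def)
        then have "dist (T i l y) (T i N y) \<le> c"
          using that by (auto simp: G_def c_def not_less)
        moreover have "dist (T i N y) (T i N x) < c"
          using that by (simp add: V_def)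
        ultimately show ?thesis
          using dist_triangle[of "T i l y" "T i N x" "T i N y"] by simp
      qed
      have "dist (T i n u) (T i m v) < 4 * c"
        using near[of u n] near[of v m] uv nm
          dist_triangle2[of "T i n u" "T i m v" "T i N x"] by simp
      then show False
        using * k by (simp add: c_def)
    qed
    then have inG: "x \<in> G i k N" for N
      using x i unfolding \<G>_def by fastforce
    have "\<not> convergent (\<lambda>n. T i n x)"
    proof
      assume "convergent (\<lambda>n. T i n x)"
      then have "Cauchy (\<lambda>n. T i n x)"
        by (rule convergent_Cauchy)
      then obtain N where N: "\<And>n m. n \<ge> N \<Longrightarrow> m \<ge> N \<Longrightarrow> dist (T i n x) (T i m x) < c"
        using metric_CauchyD[OF _ \<open>c > 0\<close>] by metis
      obtain n m where "n \<ge> N" "m \<ge> N" "c < dist (T i n x) (T i m x)"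
        using inG[of N] by (auto simp: G_def c_def)
      with N[of n m] show False by simp
    qed
    with i show "x \<in> {x. \<exists>i\<in>S. \<not> convergent (\<lambda>n. T i n x)}"
      by auto
  qed
  ultimately show ?thesis
    unfolding baire_generic_def by blast
qed

section \<open>Transport plans between finite distributions\<close>

text \<open>
  Two finite distributions, on \<open>I\<close> and on \<open>J\<close>, are both split into blocks \<open>k \<in> K\<close>; the matrices \<open>p\<close> and
  \<open>q\<close> record how the mass of each atom is shared among the blocks.  In each block as much mass as both
  distributions have there is matched by a product plan, at cost at most \<open>\<epsilon>\<close> per unit of mass because
  atoms that share a block are close.  The remaining mass is at most the total discrepancy of
  the block masses, and it may be matched arbitrarily, at cost at most \<open>D\<close>.
\<close>

lemma transport_plan_from_blocks:
  fixes p :: "'i \<Rightarrow> 'k \<Rightarrow> real" and q :: "'j \<Rightarrow> 'k \<Rightarrow> real" and c :: "'i \<Rightarrow> 'j \<Rightarrow> real"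
  assumes fin: "finite I" "finite J" "finite K"
    and p0: "\<And>i k. 0 \<le> p i k" and q0: "\<And>j k. 0 \<le> q j k"
    and p1: "(\<Sum>i\<in>I. \<Sum>k\<in>K. p i k) = 1" and q1: "(\<Sum>j\<in>J. \<Sum>k\<in>K. q j k) = 1"
    and \<epsilon>: "0 \<le> \<epsilon>" and D: "\<And>i j. c i j \<le> D" "0 \<le> D"
    and near: "\<And>i j k. \<lbrakk>k \<in> K; p i k \<noteq> 0; q j k \<noteq> 0\<rbrakk> \<Longrightarrow> c i j \<le> \<epsilon>"
  obtains w where "\<And>i j. 0 \<le> w i j"
    and "\<And>i. i \<in> I \<Longrightarrow> (\<Sum>j\<in>J. w i j) = (\<Sum>k\<in>K. p i k)"
    and "\<And>j. j \<in> J \<Longrightarrow> (\<Sum>i\<in>I. w i j) = (\<Sum>k\<in>K. q j k)"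
    and "(\<Sum>i\<in>I. \<Sum>j\<in>J. w i j * c i j)
           \<le> \<epsilon> + D * (\<Sum>k\<in>K. \<bar>(\<Sum>i\<in>I. p i k) - (\<Sum>j\<in>J. q j k)\<bar>)"
proof -
  define \<alpha> where "\<alpha> k = (\<Sum>i\<in>I. p i k)" for k
  define \<beta> where "\<beta> k = (\<Sum>j\<in>J. q j k)" for k
  \<comment> \<open>In block \<open>k\<close> the matched mass is \<open>min (\<alpha> k) (\<beta> k)\<close>, and \<open>g k\<close> normalises the product plan there to
    that mass; a block that one distribution does not charge gets \<open>g k = 0\<close> by division by zero.\<close>
  define g where "g k = min (\<alpha> k) (\<beta> k) / (\<alpha> k * \<beta> k)" for k
  \<comment> \<open>The marginals of the unmatched mass; both have the same total \<open>R\<close>.  If \<open>R = 0\<close> they vanish, so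
    the default value of division by zero is the right one in \<open>w\<close>.\<close>
  define r where "r i = (\<Sum>k\<in>K. p i k * (1 - g k * \<beta> k))" for i
  define s where "s j = (\<Sum>k\<in>K. q j k * (1 - g k * \<alpha> k))" for j
  define R where "R = (\<Sum>i\<in>I. r i)"
  define w where "w i j = (\<Sum>k\<in>K. g k * p i k * q j k) + r i * s j / R" for i j
  have \<alpha>0: "0 \<le> \<alpha> k" and \<beta>0: "0 \<le> \<beta> k" for k
    unfolding \<alpha>_def \<beta>_def using p0 q0 by (auto intro: sum_nonneg)
  have g0: "0 \<le> g k" for k
    unfolding g_def using \<alpha>0 \<beta>0 by simp
  have g\<beta>: "g k * \<beta> k \<le> 1" and g\<alpha>: "g k * \<alpha> k \<le> 1" for k
    using \<alpha>0[of k] \<beta>0[of k] by (auto simp: g_def field_simps min_def)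
  have r0: "0 \<le> r i" for i
    unfolding r_def using p0 g\<beta> by (auto intro!: sum_nonneg mult_nonneg_nonneg)
  have s0: "0 \<le> s j" for j
    unfolding s_def using q0 g\<alpha> by (auto intro!: sum_nonneg mult_nonneg_nonneg)
  have R0: "0 \<le> R"
    unfolding R_def using r0 by (auto intro: sum_nonneg)
  have sum\<alpha>: "(\<Sum>k\<in>K. \<alpha> k) = 1" and sum\<beta>: "(\<Sum>k\<in>K. \<beta> k) = 1"
    unfolding \<alpha>_def \<beta>_def using p1 q1 by (simp_all add: sum.swap[of _ K])
  have "R = (\<Sum>k\<in>K. \<Sum>i\<in>I. p i k * (1 - g k * \<beta> k))"
    unfolding R_def r_def by (rule sum.swap)
  also have "\<dots> = (\<Sum>k\<in>K. \<alpha> k * (1 - g k * \<beta> k))"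
    by (simp add: \<alpha>_def sum_distrib_right)
  finally have R1: "R = (\<Sum>k\<in>K. \<alpha> k * (1 - g k * \<beta> k))" .
  then have R2: "R = 1 - (\<Sum>k\<in>K. g k * \<alpha> k * \<beta> k)"
    by (simp add: algebra_simps sum_subtractf sum\<alpha>)
  have "(\<Sum>j\<in>J. s j) = (\<Sum>k\<in>K. \<Sum>j\<in>J. q j k * (1 - g k * \<alpha> k))"
    unfolding s_def by (rule sum.swap)
  also have "\<dots> = (\<Sum>k\<in>K. \<beta> k * (1 - g k * \<alpha> k))"
    by (simp add: \<beta>_def sum_distrib_right)
  also have "\<dots> = R"
    by (simp add: R2 algebra_simps sum_subtractf sum\<beta>)
  finally have sR: "(\<Sum>j\<in>J. s j) = R" .
  have Rle: "R \<le> (\<Sum>k\<in>K. \<bar>\<alpha> k - \<beta> k\<bar>)"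
    unfolding R1
  proof (rule sum_mono)
    fix k
    show "\<alpha> k * (1 - g k * \<beta> k) \<le> \<bar>\<alpha> k - \<beta> k\<bar>"
      using \<alpha>0[of k] \<beta>0[of k]
      by (cases "\<alpha> k = 0"; cases "\<beta> k = 0") (auto simp: g_def field_simps min_def)
  qed
  have rR: "r i * R / R = r i" if "i \<in> I" for i
  proof (cases "R = 0")
    case True
    then have "r i = 0"
      using sum_nonneg_eq_0_iff[OF fin(1), of r] r0 that unfolding R_def by auto
    then show ?thesis by simp
  qed simp
  have sR': "R * s j / R = s j" if "j \<in> J" for j
  proof (cases "R = 0")
    case True
    then have "s j = 0"
      using sum_nonneg_eq_0_iff[OF fin(2), of s] s0 that sR by auto
    then show ?thesis by simp
  qed simp
  show thesis
  proof (rule that[of w])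
    show "0 \<le> w i j" for i j
      unfolding w_def using g0 p0 q0 r0 s0 R0 by (auto intro!: add_nonneg_nonneg sum_nonneg)
    show "(\<Sum>j\<in>J. w i j) = (\<Sum>k\<in>K. p i k)" if "i \<in> I" for i
    proof -
      have "(\<Sum>j\<in>J. w i j) = (\<Sum>k\<in>K. \<Sum>j\<in>J. g k * p i k * q j k) + r i * (\<Sum>j\<in>J. s j) / R"
        unfolding w_def sum.distrib
        by (subst sum.swap) (simp add: sum_distrib_left sum_divide_distrib)
      also have "\<dots> = (\<Sum>k\<in>K. g k * p i k * \<beta> k) + r i"
        using rR[OF that] by (simp add: sR \<beta>_def sum_distrib_left)
      also have "\<dots> = (\<Sum>k\<in>K. p i k)"
        by (simp add: r_def algebra_simps sum_subtractf)
      finally show ?thesis .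
    qed
    show "(\<Sum>i\<in>I. w i j) = (\<Sum>k\<in>K. q j k)" if "j \<in> J" for j
    proof -
      have "(\<Sum>i\<in>I. w i j) = (\<Sum>k\<in>K. \<Sum>i\<in>I. g k * p i k * q j k) + (\<Sum>i\<in>I. r i) * s j / R"
        unfolding w_def sum.distrib
        by (subst sum.swap) (simp add: sum_distrib_right sum_divide_distrib)
      also have "\<dots> = (\<Sum>k\<in>K. g k * \<alpha> k * q j k) + s j"
        using sR'[OF that] by (simp add: R_def[symmetric] \<alpha>_def sum_distrib_left sum_distrib_right)
      also have "\<dots> = (\<Sum>k\<in>K. q j k)"
        by (simp add: s_def algebra_simps sum_subtractf)
      finally show ?thesis .
    qed
    have "(\<Sum>i\<in>I. \<Sum>j\<in>J. w i j * c i j)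
       = (\<Sum>i\<in>I. \<Sum>j\<in>J. \<Sum>k\<in>K. g k * p i k * q j k * c i j)
         + (\<Sum>i\<in>I. \<Sum>j\<in>J. r i * s j / R * c i j)"
      unfolding w_def by (simp add: distrib_right sum.distrib sum_distrib_right)
    also have "\<dots> \<le> (\<Sum>i\<in>I. \<Sum>j\<in>J. \<Sum>k\<in>K. g k * p i k * q j k * \<epsilon>)
         + (\<Sum>i\<in>I. \<Sum>j\<in>J. r i * s j / R * D)"
    proof (intro add_mono sum_mono)
      fix i j k assume "k \<in> K"
      show "g k * p i k * q j k * c i j \<le> g k * p i k * q j k * \<epsilon>"
      proof (cases "p i k = 0 \<or> q j k = 0")
        case False
        then show ?thesis
          using near[OF \<open>k \<in> K\<close>, of i j] g0 p0 q0 by (intro mult_left_mono) auto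
      qed auto
    next
      fix i j
      show "r i * s j / R * c i j \<le> r i * s j / R * D"
        using D r0 s0 R0 by (intro mult_left_mono) auto
    qed
    also have "(\<Sum>i\<in>I. \<Sum>j\<in>J. \<Sum>k\<in>K. g k * p i k * q j k * \<epsilon>) = (\<Sum>k\<in>K. g k * \<alpha> k * \<beta> k) * \<epsilon>"
    proof -
      have "(\<Sum>i\<in>I. \<Sum>j\<in>J. \<Sum>k\<in>K. g k * p i k * q j k * \<epsilon>)
          = (\<Sum>k\<in>K. \<Sum>i\<in>I. \<Sum>j\<in>J. g k * p i k * q j k * \<epsilon>)"
        by (simp add: sum.swap[of _ K])
      also have "\<dots> = (\<Sum>k\<in>K. g k * \<alpha> k * \<beta> k) * \<epsilon>"
        unfolding sum_distrib_right
      proof (rule sum.cong[OF refl])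
        fix k
        have "(\<Sum>i\<in>I. \<Sum>j\<in>J. g k * p i k * q j k * \<epsilon>) = g k * \<epsilon> * (\<alpha> k * \<beta> k)"
          unfolding \<alpha>_def \<beta>_def sum_product by (simp add: sum_distrib_left mult_ac)
        then show "(\<Sum>i\<in>I. \<Sum>j\<in>J. g k * p i k * q j k * \<epsilon>) = g k * \<alpha> k * \<beta> k * \<epsilon>"
          by simp
      qed
      finally show ?thesis .
    qed
    also have "(\<Sum>i\<in>I. \<Sum>j\<in>J. r i * s j / R * D) = R * R / R * D"
    proof -
      have "(\<Sum>i\<in>I. \<Sum>j\<in>J. r i * s j / R * D) = (\<Sum>i\<in>I. r i) * (\<Sum>j\<in>J. s j) / R * D"
        unfolding sum_product unfolding sum_divide_distrib unfolding sum_distrib_right by simp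
      then show ?thesis
        by (simp only: sR R_def[symmetric])
    qed
    also have "(\<Sum>k\<in>K. g k * \<alpha> k * \<beta> k) * \<epsilon> + R * R / R * D \<le> \<epsilon> + D * R"
      using R2 R0 \<epsilon> by (auto simp: mult.commute intro!: mult_left_le)
    also have "\<dots> \<le> \<epsilon> + D * (\<Sum>k\<in>K. \<bar>\<alpha> k - \<beta> k\<bar>)"
      using Rle D by (intro add_left_mono mult_left_mono)
    finally show "(\<Sum>i\<in>I. \<Sum>j\<in>J. w i j * c i j)
        \<le> \<epsilon> + D * (\<Sum>k\<in>K. \<bar>(\<Sum>i\<in>I. p i k) - (\<Sum>j\<in>J. q j k)\<bar>)"
      by (simp add: \<alpha>_def \<beta>_def)
  qed
qed

section \<open>Empirical measures, Birkhoff averages and couplings\<close>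

definition birkhoff_average :: "('b \<Rightarrow> real) \<Rightarrow> ('b \<Rightarrow> 'b) \<Rightarrow> nat \<Rightarrow> 'b \<Rightarrow> real" where
  "birkhoff_average \<phi> h n y = (\<Sum>i<n. \<phi> ((h ^^ i) y)) / real n"

lemma empirical_measure_eq_distr:
  assumes "n > 0"
  shows "empirical_measure h n y =
    distr (uniform_count_measure {..<n}) borel (\<lambda>i. (h ^^ i) y)"
proof (rule measure_eqI)
  fix A assume "A \<in> sets (empirical_measure h n y)"
  then have A: "A \<in> sets borel" by simp
  let ?I = "(\<lambda>i. (h ^^ i) y) -` A \<inter> {..<n}"
  have I: "{..<n} \<inter> {i. (h ^^ i) y \<in> A} = ?I"
    by auto
  have "(\<Sum>i<n. emeasure (return borel ((h ^^ i) y)) A) = (\<Sum>i<n. if (h ^^ i) y \<in> A then 1 else 0)"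
    using A by (intro sum.cong) (auto simp: indicator_def)
  also have "\<dots> = of_nat (card ?I)"
    by (simp add: sum.If_cases I)
  finally have "emeasure (empirical_measure h n y) A = of_nat (card ?I) / of_nat n"
    using A by (simp add: emeasure_empirical_measure)
  moreover have "emeasure (distr (uniform_count_measure {..<n}) borel (\<lambda>i. (h ^^ i) y)) A
      = ennreal (card ?I / n)"
    using A by (subst emeasure_distr)
      (auto simp: measurable_def space_uniform_count_measure sets_uniform_count_measure
        emeasure_uniform_count_measure)
  ultimately show "emeasure (empirical_measure h n y) A =
      emeasure (distr (uniform_count_measure {..<n}) borel (\<lambda>i. (h ^^ i) y)) A"
    using assms by (simp add: divide_ennreal ennreal_of_nat_eq_real_of_nat)
qed simp

lemma integral_empirical_measure:
  assumes "n > 0" and "\<phi> \<in> borel_measurable borel"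
  shows "(\<integral>z. \<phi> z \<partial>empirical_measure h n y) = birkhoff_average \<phi> h n y"
  using assms
  by (simp add: empirical_measure_eq_distr integral_distr integral_uniform_count_measure
      birkhoff_average_def measurable_def space_uniform_count_measure sets_uniform_count_measure)

lemma borel_measurable_fst_borel [measurable]: "fst \<in> borel_measurable borel"
  and borel_measurable_snd_borel [measurable]: "snd \<in> borel_measurable borel"
  by (intro borel_measurable_continuous_onI continuous_intros)+

lemma wasserstein_le_coupling:
  assumes "\<zeta> \<in> couplings \<nu>1 \<nu>2"
  shows "wasserstein \<nu>1 \<nu>2 \<le> (\<integral>p. dist (fst p) (snd p) \<partial>\<zeta>)"
  unfolding wasserstein_def
  using assms by (intro cINF_lower bdd_belowI[where m = 0]) auto

text \<open>
  A plan is indexed by pairs of times rather than pairs of points, so that orbits that visit a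
  point several times need no special treatment.
\<close>

lemma wasserstein_empirical_le_plan:
  fixes h g :: "'b::metric_space \<Rightarrow> 'b" and w :: "nat \<Rightarrow> nat \<Rightarrow> real"
  assumes n: "n > 0" and m: "m > 0" and w0: "\<And>i j. 0 \<le> w i j"
    and row: "\<And>i. i < n \<Longrightarrow> (\<Sum>j<m. w i j) = 1 / n"
    and col: "\<And>j. j < m \<Longrightarrow> (\<Sum>i<n. w i j) = 1 / m"
  shows "wasserstein (empirical_measure h n y) (empirical_measure g m z)
    \<le> (\<Sum>i<n. \<Sum>j<m. w i j * dist ((h ^^ i) y) ((g ^^ j) z))"
proof -
  define P where "P = point_measure ({..<n} \<times> {..<m}) (\<lambda>p. ennreal (w (fst p) (snd p)))"
  define X where "X = (\<lambda>(i, j). ((h ^^ i) y, (g ^^ j) z))"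
  define \<zeta> where "\<zeta> = distr P borel X"
  have sP [simp]: "space P = {..<n} \<times> {..<m}" "sets P = Pow ({..<n} \<times> {..<m})"
    by (simp_all add: P_def space_point_measure sets_point_measure)
  have meas: "f \<in> P \<rightarrow>\<^sub>M N" if "\<And>p. f p \<in> space N" for f N
    using that by (auto simp: measurable_def)
  have eP: "emeasure P S = (\<Sum>(i, j)\<in>S. ennreal (w i j))" if "S \<subseteq> {..<n} \<times> {..<m}" for S
    unfolding P_def using that by (subst emeasure_point_measure_finite) (auto simp: case_prod_beta)
  have marg1: "emeasure P (B \<times> {..<m}) = ennreal (card B / n)" if "B \<subseteq> {..<n}" for B
  proof -
    have "emeasure P (B \<times> {..<m}) = (\<Sum>i\<in>B. \<Sum>j<m. ennreal (w i j))"
      using that by (subst eP) (auto simp: sum.cartesian_product case_prod_beta)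
    also have "\<dots> = (\<Sum>i\<in>B. ennreal (1 / n))"
      using that w0 row by (intro sum.cong) (auto simp: sum_ennreal)
    finally show ?thesis
      by (simp add: ennreal_of_nat_eq_real_of_nat flip: ennreal_mult)
  qed
  have marg2: "emeasure P ({..<n} \<times> B) = ennreal (card B / m)" if "B \<subseteq> {..<m}" for B
  proof -
    have "emeasure P ({..<n} \<times> B) = (\<Sum>i<n. \<Sum>j\<in>B. ennreal (w i j))"
      using that by (subst eP) (auto simp: sum.cartesian_product case_prod_beta)
    also have "\<dots> = (\<Sum>j\<in>B. \<Sum>i<n. ennreal (w i j))"
      by (rule sum.swap)
    also have "\<dots> = (\<Sum>j\<in>B. ennreal (1 / m))"
      using that w0 col by (intro sum.cong) (auto simp: sum_ennreal)
    finally show ?thesis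
      by (simp add: ennreal_of_nat_eq_real_of_nat flip: ennreal_mult)
  qed
  have "emeasure P (space P) = 1"
    using marg1[of "{..<n}"] n by simp
  then interpret P: prob_space P
    by (rule prob_spaceI)
  have "prob_space \<zeta>"
    unfolding \<zeta>_def by (intro P.prob_space_distr meas) simp
  moreover have "distr \<zeta> borel fst = empirical_measure h n y"
  proof -
    have "distr \<zeta> borel fst = distr P borel (fst \<circ> X)"
      unfolding \<zeta>_def by (intro distr_distr meas) auto
    also have "\<dots> = distr (uniform_count_measure {..<n}) borel (\<lambda>i. (h ^^ i) y)"
    proof (rule measure_eqI)
      fix A :: "'b set" assume "A \<in> sets (distr P borel (fst \<circ> X))"
      then have A: "A \<in> sets borel" by simp
      let ?B = "(\<lambda>i. (h ^^ i) y) -` A \<inter> {..<n}"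
      have "(fst \<circ> X) -` A \<inter> space P = ?B \<times> {..<m}"
        by (auto simp: X_def)
      then have "emeasure (distr P borel (fst \<circ> X)) A = ennreal (card ?B / n)"
        using marg1[of ?B] A by (subst emeasure_distr) (auto intro: meas)
      then show "emeasure (distr P borel (fst \<circ> X)) A
          = emeasure (distr (uniform_count_measure {..<n}) borel (\<lambda>i. (h ^^ i) y)) A"
        using A by (subst (2) emeasure_distr)
          (auto simp: measurable_def space_uniform_count_measure sets_uniform_count_measure
            emeasure_uniform_count_measure)
    qed simp
    finally show ?thesis
      using n by (simp add: empirical_measure_eq_distr)
  qed
  moreover have "distr \<zeta> borel snd = empirical_measure g m z"
  proof -
    have "distr \<zeta> borel snd = distr P borel (snd \<circ> X)"
      unfolding \<zeta>_def by (intro distr_distr meas) auto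
    also have "\<dots> = distr (uniform_count_measure {..<m}) borel (\<lambda>j. (g ^^ j) z)"
    proof (rule measure_eqI)
      fix A :: "'b set" assume "A \<in> sets (distr P borel (snd \<circ> X))"
      then have A: "A \<in> sets borel" by simp
      let ?B = "(\<lambda>j. (g ^^ j) z) -` A \<inter> {..<m}"
      have "(snd \<circ> X) -` A \<inter> space P = {..<n} \<times> ?B"
        by (auto simp: X_def)
      then have "emeasure (distr P borel (snd \<circ> X)) A = ennreal (card ?B / m)"
        using marg2[of ?B] A by (subst emeasure_distr) (auto intro: meas)
      then show "emeasure (distr P borel (snd \<circ> X)) A
          = emeasure (distr (uniform_count_measure {..<m}) borel (\<lambda>j. (g ^^ j) z)) A"
        using A by (subst (2) emeasure_distr)
          (auto simp: measurable_def space_uniform_count_measure sets_uniform_count_measure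
            emeasure_uniform_count_measure)
    qed simp
    finally show ?thesis
      using m by (simp add: empirical_measure_eq_distr)
  qed
  ultimately have "\<zeta> \<in> couplings (empirical_measure h n y) (empirical_measure g m z)"
    by (simp add: couplings_def borel_prob_measures_def \<zeta>_def)
  then have "wasserstein (empirical_measure h n y) (empirical_measure g m z)
      \<le> (\<integral>p. dist (fst p) (snd p) \<partial>\<zeta>)"
    by (rule wasserstein_le_coupling)
  also have "\<dots> = (\<integral>p. dist (fst (X p)) (snd (X p)) \<partial>P)"
    unfolding \<zeta>_def
    by (intro integral_distr meas borel_measurable_continuous_onI continuous_intros) auto
  also have "\<dots> = (\<Sum>i<n. \<Sum>j<m. w i j * dist ((h ^^ i) y) ((g ^^ j) z))"
    unfolding P_def using w0
    by (simp add: lebesgue_integral_point_measure_finite X_def case_prod_beta sum.cartesian_product)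
  finally show ?thesis .
qed

text \<open>
  The infimum over an empty set of couplings would be an unspecified real number, so a coupling has to
  be exhibited before smallness of the Wasserstein distance says anything.  The product measure is the
  obvious one, but it lives on the product of the two Borel \<open>\<sigma>\<close>-algebras rather than on the Borel
  \<open>\<sigma>\<close>-algebra of the product.  Taking the first factor on the finite set of times removes this
  difficulty: on each of finitely many slices the map into the product space is continuous.
\<close>

lemma couplings_empirical_nonempty:
  fixes h :: "'b::metric_space \<Rightarrow> 'b"
  assumes n: "n > 0" and \<nu>: "\<nu> \<in> borel_prob_measures"
  shows "couplings (empirical_measure h n y) \<nu> \<noteq> {}"
proof -
  define U where "U = uniform_count_measure {..<n}"
  define X where "X = (\<lambda>(i, z::'b). ((h ^^ i) y, z))"
  define \<zeta> where "\<zeta> = distr (U \<Otimes>\<^sub>M \<nu>) borel X"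
  interpret \<nu>: prob_space \<nu>
    using \<nu> by (simp add: borel_prob_measures_def)
  have s\<nu> [simp, measurable_cong]: "sets \<nu> = sets borel"
    using \<nu> by (simp add: borel_prob_measures_def)
  then have [simp]: "space \<nu> = UNIV"
    by (metis sets_eq_imp_space_eq space_borel)
  interpret U: prob_space U
    unfolding U_def using n by (intro prob_space_uniform_count_measure) auto
  interpret pair_prob_space U \<nu> ..
  have sU [simp]: "space U = {..<n}" "sets U = Pow {..<n}"
    by (simp_all add: U_def space_uniform_count_measure sets_uniform_count_measure)
  have X [measurable]: "X \<in> borel_measurable (U \<Otimes>\<^sub>M \<nu>)"
  proof -
    have "X \<in> count_space {..<n} \<Otimes>\<^sub>M borel \<rightarrow>\<^sub>M borel"
      unfolding X_def
      by (rule measurable_pair_measure_countable1)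
         (auto intro!: borel_measurable_continuous_onI continuous_intros)
    also have "count_space {..<n} \<Otimes>\<^sub>M borel \<rightarrow>\<^sub>M borel = U \<Otimes>\<^sub>M \<nu> \<rightarrow>\<^sub>M borel"
      by (intro measurable_cong_sets sets_pair_measure_cong) auto
    finally show ?thesis .
  qed
  have "prob_space \<zeta>"
    unfolding \<zeta>_def by (intro prob_space_distr X)
  moreover have "distr \<zeta> borel fst = empirical_measure h n y"
  proof -
    have "distr \<zeta> borel fst = distr (U \<Otimes>\<^sub>M \<nu>) borel (fst \<circ> X)"
      unfolding \<zeta>_def by (intro distr_distr X) auto
    also have "\<dots> = distr U borel (\<lambda>i. (h ^^ i) y)"
    proof (rule measure_eqI)
      fix A :: "'b set" assume "A \<in> sets (distr (U \<Otimes>\<^sub>M \<nu>) borel (fst \<circ> X))"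
      then have A: "A \<in> sets borel" by simp
      have *: "(fst \<circ> X) -` A \<inter> space (U \<Otimes>\<^sub>M \<nu>) = ((\<lambda>i. (h ^^ i) y) -` A \<inter> {..<n}) \<times> space \<nu>"
        by (auto simp: X_def space_pair_measure)
      have "emeasure (distr (U \<Otimes>\<^sub>M \<nu>) borel (fst \<circ> X)) A
          = emeasure U ((\<lambda>i. (h ^^ i) y) -` A \<inter> {..<n}) * emeasure \<nu> (space \<nu>)"
        using A by (subst emeasure_distr)
          (auto simp only: * intro!: measurable_comp[OF X] \<nu>.emeasure_pair_measure_Times,
            auto simp: borel_measurable_fst_borel)
      then show "emeasure (distr (U \<Otimes>\<^sub>M \<nu>) borel (fst \<circ> X)) A
          = emeasure (distr U borel (\<lambda>i. (h ^^ i) y)) A"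
        using A by (subst (2) emeasure_distr)
          (auto simp: measurable_def \<nu>.emeasure_space_1 simp del: \<open>space \<nu> = UNIV\<close>)
    qed simp
    finally show ?thesis
      using n by (simp add: empirical_measure_eq_distr U_def)
  qed
  moreover have "distr \<zeta> borel snd = \<nu>"
  proof (rule measure_eqI)
    fix A :: "'b set" assume "A \<in> sets (distr \<zeta> borel snd)"
    then have A: "A \<in> sets borel" by simp
    have "snd -` A \<inter> space \<zeta> \<in> sets \<zeta>"
      using A unfolding \<zeta>_def by (intro measurable_sets[of snd _ borel]) auto
    then have S: "(snd -` A :: ('b \<times> 'b) set) \<in> sets borel"
      by (simp add: \<zeta>_def)
    have *: "X -` (snd -` A) \<inter> space (U \<Otimes>\<^sub>M \<nu>) = space U \<times> A"
      by (auto simp: X_def space_pair_measure)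
    have "emeasure (distr \<zeta> borel snd) A = emeasure \<zeta> (snd -` A)"
      using A by (subst emeasure_distr) (auto simp: \<zeta>_def)
    also have "\<dots> = emeasure (U \<Otimes>\<^sub>M \<nu>) (space U \<times> A)"
      unfolding \<zeta>_def using S by (subst emeasure_distr[OF X]) (auto simp: * simp del: sU)
    also have "\<dots> = emeasure \<nu> A"
      using A by (subst \<nu>.emeasure_pair_measure_Times) (auto simp: U.emeasure_space_1 simp del: sU)
    finally show "emeasure (distr \<zeta> borel snd) A = emeasure \<nu> A" .
  qed simp
  ultimately have "\<zeta> \<in> couplings (empirical_measure h n y) \<nu>"
    by (simp add: couplings_def borel_prob_measures_def \<zeta>_def)
  then show ?thesis by auto
qed

section \<open>Wasserstein convergence implies convergence of Birkhoff averages\<close>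

text \<open>
  Wasserstein distances only control integrals of Lipschitz functions.  On a compact space every
  continuous function is Lipschitz up to an arbitrarily small error, which serves as well and spares
  any regularity of the partition of unity used below.
\<close>

lemma continuous_imp_Lipschitz_up_to_error:
  fixes \<phi> :: "'b::compact_metric_space \<Rightarrow> real"
  assumes cont: "continuous_on UNIV \<phi>" and "\<eta> > 0"
  obtains C where "C \<ge> 0" "\<And>x y. \<bar>\<phi> x - \<phi> y\<bar> \<le> \<eta> + C * dist x y"
proof -
  have "bounded (range \<phi>)"
    using compact_continuous_image[OF cont compact_UNIV] by (rule compact_imp_bounded)
  then obtain M where M: "\<And>x. \<bar>\<phi> x\<bar> \<le> M"
    unfolding bounded_iff by auto
  obtain d where "d > 0" and d: "\<And>x y. dist x y < d \<Longrightarrow> \<bar>\<phi> x - \<phi> y\<bar> < \<eta>"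
    using compact_uniformly_continuous[OF cont compact_UNIV] \<open>\<eta> > 0\<close>
    unfolding uniformly_continuous_on_def dist_real_def by (metis UNIV_I dist_commute)
  have "0 \<le> M"
    using M[of undefined] by linarith
  show thesis
  proof (rule that[of "2 * M / d"])
    show "2 * M / d \<ge> 0"
      using \<open>0 \<le> M\<close> \<open>d > 0\<close> by simp
    fix x y
    show "\<bar>\<phi> x - \<phi> y\<bar> \<le> \<eta> + 2 * M / d * dist x y"
    proof (cases "dist x y < d")
      case True
      then show ?thesis
        using d[of x y] \<open>0 \<le> M\<close> \<open>d > 0\<close> by (auto intro!: add_increasing2)
    next
      case False
      have "\<bar>\<phi> x - \<phi> y\<bar> \<le> 2 * M"
        using M[of x] M[of y] by linarith
      also have "2 * M \<le> 2 * M / d * dist x y"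
        using False \<open>d > 0\<close> \<open>0 \<le> M\<close> by (auto simp: field_simps intro!: mult_left_mono)
      finally show ?thesis
        using \<open>\<eta> > 0\<close> by simp
    qed
  qed
qed

lemma integral_diff_le_wasserstein:
  fixes \<phi> :: "'b::compact_metric_space \<Rightarrow> real"
  assumes cont: "continuous_on UNIV \<phi>" and "C \<ge> 0"
    and lip: "\<And>x y. \<bar>\<phi> x - \<phi> y\<bar> \<le> \<eta> + C * dist x y"
    and ne: "couplings \<nu>1 \<nu>2 \<noteq> {}"
  shows "\<bar>(\<integral>x. \<phi> x \<partial>\<nu>1) - (\<integral>x. \<phi> x \<partial>\<nu>2)\<bar> \<le> \<eta> + C * wasserstein \<nu>1 \<nu>2"
proof -
  have bnd: "\<bar>(\<integral>x. \<phi> x \<partial>\<nu>1) - (\<integral>x. \<phi> x \<partial>\<nu>2)\<bar> \<le> \<eta> + C * (\<integral>p. dist (fst p) (snd p) \<partial>\<zeta>)"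
    if \<zeta>: "\<zeta> \<in> couplings \<nu>1 \<nu>2" for \<zeta>
  proof -
    interpret \<zeta>: prob_space \<zeta>
      using \<zeta> by (simp add: couplings_def borel_prob_measures_def)
    have [measurable_cong]: "sets \<zeta> = sets borel"
      and marg: "\<nu>1 = distr \<zeta> borel fst" "\<nu>2 = distr \<zeta> borel snd"
      using \<zeta> by (auto simp: couplings_def borel_prob_measures_def)
    have [measurable]: "\<phi> \<in> borel_measurable borel"
      using cont by (rule borel_measurable_continuous_onI)
    have [measurable]: "(\<lambda>p::'b \<times> 'b. dist (fst p) (snd p)) \<in> borel_measurable borel"
      by (intro borel_measurable_continuous_onI continuous_intros)
    have [measurable]: "fst \<in> \<zeta> \<rightarrow>\<^sub>M borel" "snd \<in> \<zeta> \<rightarrow>\<^sub>M borel"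
      by measurable
    have "bounded (range \<phi>)"
      using compact_continuous_image[OF cont compact_UNIV] by (rule compact_imp_bounded)
    then obtain M where M: "\<And>x. \<bar>\<phi> x\<bar> \<le> M"
      unfolding bounded_iff by auto
    have int\<phi>: "integrable \<zeta> (\<lambda>p. \<phi> (fst p))" "integrable \<zeta> (\<lambda>p. \<phi> (snd p))"
      using M by (auto intro!: \<zeta>.integrable_const_bound[where B = M])
    have "dist (fst p) (snd p) \<le> diameter (UNIV :: 'b set)" for p :: "'b \<times> 'b"
      using compact_imp_bounded[OF compact_UNIV] by (intro diameter_bounded_bound) auto
    then have intd: "integrable \<zeta> (\<lambda>p. dist (fst p) (snd p))"
      by (auto intro!: \<zeta>.integrable_const_bound[where B = "diameter (UNIV :: 'b set)"])
    have "(\<integral>x. \<phi> x \<partial>\<nu>1) - (\<integral>x. \<phi> x \<partial>\<nu>2) = (\<integral>p. \<phi> (fst p) - \<phi> (snd p) \<partial>\<zeta>)"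
      unfolding marg by (simp add: integral_distr int\<phi>)
    also have "\<bar>\<dots>\<bar> \<le> (\<integral>p. \<bar>\<phi> (fst p) - \<phi> (snd p)\<bar> \<partial>\<zeta>)"
      by (rule integral_abs_bound)
    also have "\<dots> \<le> (\<integral>p. \<eta> + C * dist (fst p) (snd p) \<partial>\<zeta>)"
      using lip by (intro integral_mono) (auto simp: int\<phi> intd)
    also have "\<dots> = \<eta> + C * (\<integral>p. dist (fst p) (snd p) \<partial>\<zeta>)"
      by (simp add: intd \<zeta>.prob_space)
    finally show ?thesis .
  qed
  show ?thesis
  proof (cases "C = 0")
    case True
    then show ?thesis
      using bnd ne by auto
  next
    case False
    have "(\<bar>(\<integral>x. \<phi> x \<partial>\<nu>1) - (\<integral>x. \<phi> x \<partial>\<nu>2)\<bar> - \<eta>) / C \<le> wasserstein \<nu>1 \<nu>2"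
      unfolding wasserstein_def
    proof (rule cINF_greatest[OF ne])
      fix \<zeta> assume "\<zeta> \<in> couplings \<nu>1 \<nu>2"
      then show "(\<bar>(\<integral>x. \<phi> x \<partial>\<nu>1) - (\<integral>x. \<phi> x \<partial>\<nu>2)\<bar> - \<eta>) / C \<le> (\<integral>p. dist (fst p) (snd p) \<partial>\<zeta>)"
        using bnd[of \<zeta>] False \<open>C \<ge> 0\<close> by (simp add: field_simps)
    qed
    then show ?thesis
      using False \<open>C \<ge> 0\<close> by (simp add: field_simps)
  qed
qed

lemma birkhoff_average_tendsto_integral:
  fixes \<phi> :: "'b::compact_metric_space \<Rightarrow> real"
  assumes cont: "continuous_on UNIV \<phi>" and \<nu>: "\<nu> \<in> borel_prob_measures"
    and conv: "(\<lambda>n. wasserstein (empirical_measure h n y) \<nu>) \<longlonglongrightarrow> 0"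
  shows "(\<lambda>n. birkhoff_average \<phi> h n y) \<longlonglongrightarrow> (\<integral>x. \<phi> x \<partial>\<nu>)"
proof (rule tendstoI)
  fix e :: real assume "e > 0"
  obtain C where "C \<ge> 0" and C: "\<And>x y. \<bar>\<phi> x - \<phi> y\<bar> \<le> e / 2 + C * dist x y"
    using continuous_imp_Lipschitz_up_to_error[OF cont, of "e / 2"] \<open>e > 0\<close> by auto
  have "(\<lambda>n. e / 2 + C * wasserstein (empirical_measure h n y) \<nu>) \<longlonglongrightarrow> e / 2 + C * 0"
    by (intro tendsto_intros conv)
  then have "\<forall>\<^sub>F n in sequentially. e / 2 + C * wasserstein (empirical_measure h n y) \<nu> < e"
    using \<open>e > 0\<close> by (intro order_tendstoD(2)[where y = "e / 2 + C * 0"]) auto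
  then show "\<forall>\<^sub>F n in sequentially. dist (birkhoff_average \<phi> h n y) (\<integral>x. \<phi> x \<partial>\<nu>) < e"
    using eventually_gt_at_top[of 0]
  proof eventually_elim
    case (elim n)
    then show ?case
      using integral_diff_le_wasserstein[OF cont \<open>C \<ge> 0\<close> C couplings_empirical_nonempty[OF _ \<nu>, of n h y]]
        integral_empirical_measure[OF _ borel_measurable_continuous_onI[OF cont], of n h y]
      by (simp add: dist_real_def)
  qed
qed

section \<open>Birkhoff averages control the Wasserstein distance\<close>

text \<open>
  A quantitative form of the fact that weak convergence implies Wasserstein convergence.  The test
  functions are a partition of unity subordinate to a cover by small balls.  They share out every orbit
  point among the balls, and if the Birkhoff averages agree, then the two empirical measures give nearly
  the same mass to each ball, so almost all mass can be transported within the balls.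
\<close>

lemma finitely_many_functions_control_wasserstein:
  fixes \<epsilon> :: real
  assumes "\<epsilon> > 0"
  obtains \<Phi> :: "('b::compact_metric_space \<Rightarrow> real) set" and \<delta> :: real
  where "finite \<Phi>" "\<And>\<phi>. \<phi> \<in> \<Phi> \<Longrightarrow> continuous_on UNIV \<phi>" "\<delta> > 0"
    and "\<And>h g y z n m. \<lbrakk>n > 0; m > 0;
           \<And>\<phi>. \<phi> \<in> \<Phi> \<Longrightarrow> \<bar>birkhoff_average \<phi> h n y - birkhoff_average \<phi> g m z\<bar> < \<delta>\<rbrakk>
         \<Longrightarrow> wasserstein (empirical_measure h n y) (empirical_measure g m z) \<le> \<epsilon>"
proof -
  obtain X :: "'b set" where "finite X" and X: "UNIV \<subseteq> (\<Union>x\<in>X. ball x (\<epsilon> / 4))"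
    using compactE_image[OF compact_UNIV, of UNIV "\<lambda>x::'b. ball x (\<epsilon> / 4)"] \<open>\<epsilon> > 0\<close>
    by (metis (no_types, lifting) UNIV_I UN_iff centre_in_ball open_ball subsetI zero_less_divide_iff
        zero_less_numeral)
  define \<C> where "\<C> = (\<lambda>x. ball x (\<epsilon> / 4)) ` X"
  have fin\<C>: "finite \<C>"
    using \<open>finite X\<close> by (simp add: \<C>_def)
  have small: "dist x y \<le> \<epsilon> / 2" if "U \<in> \<C>" "x \<in> U" "y \<in> U" for U x y
  proof -
    obtain c where "U = ball c (\<epsilon> / 4)"
      using \<open>U \<in> \<C>\<close> by (auto simp: \<C>_def)
    then have "dist c x < \<epsilon> / 4" "dist c y < \<epsilon> / 4"
      using \<open>x \<in> U\<close> \<open>y \<in> U\<close> by simp_all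
    then show ?thesis
      using dist_triangle3[of x y c] by simp
  qed
  obtain P :: "'b set \<Rightarrow> 'b \<Rightarrow> real"
    where P: "\<And>U. U \<in> \<C> \<Longrightarrow> continuous_on UNIV (P U) \<and> (\<forall>x\<in>UNIV. 0 \<le> P U x)"
      and supp: "\<And>x U. U \<in> \<C> \<Longrightarrow> x \<in> UNIV \<Longrightarrow> x \<notin> U \<Longrightarrow> P U x = 0"
      and unity: "\<And>x. x \<in> UNIV \<Longrightarrow> supp_sum (\<lambda>U. P U x) \<C> = 1"
  proof (rule subordinate_partition_of_unity[of "UNIV :: 'b set" \<C>])
    show "UNIV \<subseteq> \<Union>\<C>" "\<And>T. T \<in> \<C> \<Longrightarrow> open T"
      using X by (auto simp: \<C>_def)
    show "\<exists>V. open V \<and> x \<in> V \<and> finite {U \<in> \<C>. U \<inter> V \<noteq> {}}" for x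
      using fin\<C> by (intro exI[of _ UNIV]) auto
  qed (use that in blast)
  have sum1: "(\<Sum>U\<in>\<C>. P U x) = 1" for x
  proof -
    have "(\<Sum>U\<in>\<C>. P U x) = supp_sum (\<lambda>U. P U x) \<C>"
      unfolding supp_sum_def support_on_def by (rule sum.mono_neutral_right[OF fin\<C>]) auto
    then show ?thesis
      using unity[of x] by simp
  qed
  define D where "D = diameter (UNIV :: 'b set)"
  have D: "dist x y \<le> D" for x y :: 'b
    unfolding D_def using compact_imp_bounded[OF compact_UNIV] by (intro diameter_bounded_bound) auto
  have "0 \<le> D"
    using D[of undefined undefined] by simp
  \<comment> \<open>The added units keep the denominator positive if the space is a single point.\<close>
  define \<delta> where "\<delta> = \<epsilon> / (2 * (D + 1) * (real (card \<C>) + 1))"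
  have "\<delta> > 0"
    unfolding \<delta>_def using \<open>\<epsilon> > 0\<close> \<open>0 \<le> D\<close> by (intro divide_pos_pos mult_pos_pos) auto
  have small_total: "D * (real (card \<C>) * \<delta>) \<le> \<epsilon> / 2"
  proof -
    have "D * (real (card \<C>) * \<delta>) \<le> (D + 1) * ((real (card \<C>) + 1) * \<delta>)"
      using \<open>0 \<le> D\<close> \<open>\<delta> > 0\<close> by (intro mult_mono) auto
    also have "\<dots> = \<epsilon> / 2"
    proof -
      have *: "a * (b * (\<epsilon> / (2 * a * b))) = \<epsilon> / 2" if "a > 0" "b > 0" for a b :: real
        using that by simp
      then show ?thesis
        unfolding \<delta>_def using \<open>0 \<le> D\<close> by (intro *) auto
    qed
    finally show ?thesis .
  qed
  show thesis
  proof (rule that[of "P ` \<C>" \<delta>])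
    show "finite (P ` \<C>)" "\<delta> > 0"
      using fin\<C> \<open>\<delta> > 0\<close> by auto
    show "continuous_on UNIV \<phi>" if "\<phi> \<in> P ` \<C>" for \<phi>
      using that P by auto
  next
    fix h g :: "'b \<Rightarrow> 'b" and y z :: 'b and n m :: nat
    assume n: "n > 0" and m: "m > 0"
      and close: "\<And>\<phi>. \<phi> \<in> P ` \<C> \<Longrightarrow> \<bar>birkhoff_average \<phi> h n y - birkhoff_average \<phi> g m z\<bar> < \<delta>"
    define p where "p i U = (if U \<in> \<C> then P U ((h ^^ i) y) / n else 0)" for i :: nat and U
    define q where "q j U = (if U \<in> \<C> then P U ((g ^^ j) z) / m else 0)" for j :: nat and U
    have rowp: "(\<Sum>U\<in>\<C>. p i U) = 1 / n" and rowq: "(\<Sum>U\<in>\<C>. q i U) = 1 / m" for i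
      unfolding p_def q_def using sum1 by (simp_all flip: sum_divide_distrib)
    have colp: "(\<Sum>i<n. p i U) = birkhoff_average (P U) h n y"
      and colq: "(\<Sum>j<m. q j U) = birkhoff_average (P U) g m z" if "U \<in> \<C>" for U
      using that by (simp_all add: p_def q_def birkhoff_average_def flip: sum_divide_distrib)
    obtain w where w: "\<And>i j. 0 \<le> w i j"
      "\<And>i. i \<in> {..<n} \<Longrightarrow> (\<Sum>j<m. w i j) = (\<Sum>U\<in>\<C>. p i U)"
      "\<And>j. j \<in> {..<m} \<Longrightarrow> (\<Sum>i<n. w i j) = (\<Sum>U\<in>\<C>. q j U)"
      "(\<Sum>i<n. \<Sum>j<m. w i j * dist ((h ^^ i) y) ((g ^^ j) z))
         \<le> \<epsilon> / 2 + D * (\<Sum>U\<in>\<C>. \<bar>(\<Sum>i<n. p i U) - (\<Sum>j<m. q j U)\<bar>)"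
    proof (rule transport_plan_from_blocks[of "{..<n}" "{..<m}" \<C> p q "\<epsilon> / 2"
          "\<lambda>i j. dist ((h ^^ i) y) ((g ^^ j) z)" D])
      show "0 \<le> p i U" "0 \<le> q i U" for i U
        using P by (auto simp: p_def q_def)
      show "(\<Sum>i<n. \<Sum>U\<in>\<C>. p i U) = 1" "(\<Sum>j<m. \<Sum>U\<in>\<C>. q j U) = 1"
        using n m by (simp_all add: rowp rowq)
      show "dist ((h ^^ i) y) ((g ^^ j) z) \<le> \<epsilon> / 2"
        if "U \<in> \<C>" "p i U \<noteq> 0" "q j U \<noteq> 0" for i j U
        using that supp[of U] by (intro small[of U]) (auto simp: p_def q_def)
    qed (use fin\<C> \<open>\<epsilon> > 0\<close> D \<open>0 \<le> D\<close> in auto)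
    have "wasserstein (empirical_measure h n y) (empirical_measure g m z)
        \<le> (\<Sum>i<n. \<Sum>j<m. w i j * dist ((h ^^ i) y) ((g ^^ j) z))"
      using w rowp rowq by (intro wasserstein_empirical_le_plan n m) auto
    also have "\<dots> \<le> \<epsilon> / 2 + D * (\<Sum>U\<in>\<C>. \<bar>(\<Sum>i<n. p i U) - (\<Sum>j<m. q j U)\<bar>)"
      by (rule w(4))
    also have "\<dots> \<le> \<epsilon> / 2 + D * (\<Sum>U\<in>\<C>. \<delta>)"
      using close \<open>0 \<le> D\<close>
      by (intro add_left_mono mult_left_mono sum_mono) (auto simp: colp colq intro: less_imp_le)
    also have "\<dots> \<le> \<epsilon>"
      using small_total by simp
    finally show "wasserstein (empirical_measure h n y) (empirical_measure g m z) \<le> \<epsilon>" .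
  qed
qed

section \<open>Orbits of the added point\<close>

lemma continuous_on_Orig: "continuous_on UNIV (Orig :: 'a::compact_metric_space \<Rightarrow> 'a pointed)"
  unfolding continuous_on_iff
proof (intro ballI allI impI)
  fix x :: 'a and e :: real assume "e > 0"
  then show "\<exists>d>0. \<forall>x'\<in>UNIV. dist x' x < d \<longrightarrow> dist (Orig x') (Orig x) < e"
    using metric_scale_pos[where 'a = 'a]
    by (intro exI[of _ "e / metric_scale TYPE('a)"]) (auto simp: field_simps)
qed

instance pointed :: (compact_metric_space) compact_metric_space
proof
  have "(UNIV :: 'a pointed set) = insert Added (range Orig)"
    by (auto intro: pointed.exhaust)
  moreover have "compact (range (Orig :: 'a \<Rightarrow> 'a pointed))"
    by (intro compact_continuous_image continuous_on_Orig compact_UNIV)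
  ultimately show "compact (UNIV :: 'a pointed set)"
    by (metis compact_insert)
qed

lemma funpow_pointed_map_Added: "(pointed_map f u ^^ Suc i) Added = Orig ((f ^^ i) u)"
  by (induction i) auto

lemma birkhoff_average_pointed_map:
  "birkhoff_average \<phi> (pointed_map f u) (Suc n) Added =
     \<phi> Added / real (Suc n) + real n / real (Suc n) * birkhoff_average (\<phi> \<circ> Orig) f n u"
  unfolding birkhoff_average_def
  by (simp add: sum.lessThan_Suc_shift funpow_pointed_map_Added add_divide_distrib
      del: funpow.simps sum.lessThan_Suc)

lemma continuous_on_birkhoff_average_pointed_map:
  fixes f :: "'a::compact_metric_space \<Rightarrow> 'a"
  assumes "continuous_on UNIV f" "continuous_on UNIV \<phi>"
  shows "continuous_on UNIV (\<lambda>u. birkhoff_average \<phi> (pointed_map f u) n Added)"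
proof -
  have "continuous_on UNIV (\<lambda>u. (pointed_map f u ^^ i) Added)" for i
  proof (cases i)
    case (Suc j)
    have "continuous_on UNIV (f ^^ j)"
    proof (induction j)
      case (Suc j)
      then show ?case
        using continuous_on_compose2[OF assms(1), of UNIV "f ^^ j"] by (simp add: comp_def)
    qed (simp add: id_def)
    then show ?thesis
      using continuous_on_compose2[OF continuous_on_Orig] Suc
      by (simp add: funpow_pointed_map_Added del: funpow.simps)
  qed simp
  then have "continuous_on UNIV (\<lambda>u. \<phi> ((pointed_map f u ^^ i) Added))" for i
    by (intro continuous_on_compose2[OF assms(2)]) auto
  then show ?thesis
    unfolding birkhoff_average_def divide_inverse by (intro continuous_intros)
qed

lemma not_convergent_birkhoff_average_imp_non_statistical:
  fixes f :: "'a::compact_metric_space \<Rightarrow> 'a"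
  assumes cont: "continuous_on UNIV \<phi>"
    and div: "\<not> convergent (\<lambda>n. birkhoff_average \<phi> (pointed_map f x) n Added)"
  shows "non_statistical f x"
  unfolding non_statistical_def
proof
  assume "\<exists>\<nu>\<in>borel_prob_measures. (\<lambda>n. wasserstein (empirical_measure f n x) \<nu>) \<longlonglongrightarrow> 0"
  then obtain \<nu> where \<nu>: "\<nu> \<in> borel_prob_measures"
    "(\<lambda>n. wasserstein (empirical_measure f n x) \<nu>) \<longlonglongrightarrow> 0" by auto
  have "continuous_on UNIV (\<phi> \<circ> Orig)"
    using continuous_on_compose[OF continuous_on_Orig] cont continuous_on_subset by blast
  note lim = birkhoff_average_tendsto_integral[OF this \<nu>]
  have "(\<lambda>n. \<phi> Added / real (Suc n)) \<longlonglongrightarrow> 0"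
    using LIMSEQ_Suc[OF lim_const_over_n] .
  moreover have "(\<lambda>n. real n / real (Suc n)) \<longlonglongrightarrow> 1"
    using LIMSEQ_n_over_Suc_n .
  ultimately have "(\<lambda>n. birkhoff_average \<phi> (pointed_map f x) (Suc n) Added) \<longlonglongrightarrow>
      0 + 1 * (\<integral>z. (\<phi> \<circ> Orig) z \<partial>\<nu>)"
    unfolding birkhoff_average_pointed_map by (intro tendsto_add tendsto_mult lim)
  from convergentI[OF LIMSEQ_imp_Suc[OF this]] div show False
    by (rule notE[rotated])
qed

section \<open>Generic points are non-statistical\<close>

text \<open>
  The reference measure is the point mass at the added point, so the integral is the value there.  The
  infima over \<open>N\<close> and over neighbourhoods become universal quantifiers, and the positive limit
  bounds them all from below by one constant.
\<close>

lemma statistically_unstable_point_imp_wasserstein_oscillation: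
  fixes f :: "'a::compact_metric_space \<Rightarrow> 'a"
  assumes "statistically_unstable_point f x"
  shows "\<exists>l::nat. \<forall>N V. open V \<longrightarrow> x \<in> V \<longrightarrow> (\<exists>u\<in>V. \<exists>v\<in>V. \<exists>n\<ge>N. \<exists>m\<ge>N.
    inverse (real (Suc l)) < wasserstein (empirical_measure (pointed_map f u) n Added)
        (empirical_measure (pointed_map f v) m Added))"
proof -
  define L where "L = lim (instability_at (return borel Added) (pointed_map_topology f) (pointed_map f x))"
  have "L > 0"
    using assms by (simp add: statistically_unstable_point_def statistically_unstable_def L_def)
  have L_le: "L \<le> instability_at (return borel Added) (pointed_map_topology f) (pointed_map f x) N" for N
    unfolding L_def
    by (rule decseq_ge[OF decseq_instability_at])
       (use convergent_instability_at in \<open>simp add: convergent_LIMSEQ_iff\<close>)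
  obtain e :: real where "e > 0" "ennreal e < L"
  proof -
    obtain a where "0 < a" "a < L"
      using dense[OF \<open>L > 0\<close>] by auto
    moreover from this have "a < \<top>"
      using top.not_eq_extremum by fastforce
    ultimately show thesis
      using that[of "enn2real a"] by (simp add: enn2real_positive_iff)
  qed
  obtain l where l: "inverse (real (Suc l)) < e"
    using reals_Archimedean[OF \<open>e > 0\<close>] by auto
  show ?thesis
  proof (intro exI[of _ l] allI impI)
    fix N and V :: "'a set" assume V: "open V" "x \<in> V"
    have AE: "AE y in return borel (Added :: 'a pointed). y = Added"
      by (subst AE_return) auto
    have "ennreal e < L" by fact
    also have "L \<le> (SUP h\<in>pointed_map f ` V. SUP g\<in>pointed_map f ` V.
        \<integral>\<^sup>+y. (SUP n\<in>{N..}. SUP m\<in>{N..}.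
          ennreal (wasserstein (empirical_measure h n y) (empirical_measure g m y)))
          \<partial>return borel Added)"
      unfolding instability_at_def
      by (rule order_trans[OF L_le[of N, unfolded instability_at_def]], rule INF_lower)
         (use V in \<open>auto simp: openin_pointed_map_topology\<close>)
    also have "\<dots> = (SUP h\<in>pointed_map f ` V. SUP g\<in>pointed_map f ` V.
        \<integral>\<^sup>+y. (SUP n\<in>{N..}. SUP m\<in>{N..}.
          ennreal (wasserstein (empirical_measure h n Added) (empirical_measure g m Added)))
          \<partial>return borel (Added :: 'a pointed))"
      by (intro SUP_cong refl nn_integral_cong_AE) (use AE in \<open>auto\<close>)
    also have "\<dots> = (SUP h\<in>pointed_map f ` V. SUP g\<in>pointed_map f ` V. 
        SUP n\<in>{N..}. SUP m\<in>{N..}.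
          ennreal (wasserstein (empirical_measure h n Added) (empirical_measure g m Added)))"
      by simp
    finally obtain u v n m where "u \<in> V" "v \<in> V" "n \<ge> N" "m \<ge> N"
      "ennreal e < ennreal (wasserstein (empirical_measure (pointed_map f u) n Added)
          (empirical_measure (pointed_map f v) m Added))"
      unfolding less_SUP_iff by auto
    moreover from this have "e < wasserstein (empirical_measure (pointed_map f u) n Added)
          (empirical_measure (pointed_map f v) m Added)"
      using \<open>e > 0\<close> by (simp add: ennreal_less_iff)
    ultimately show "\<exists>u\<in>V. \<exists>v\<in>V. \<exists>n\<ge>N. \<exists>m\<ge>N.
      inverse (real (Suc l)) < wasserstein (empirical_measure (pointed_map f u) n Added)
        (empirical_measure (pointed_map f v) m Added)"
      using l by (meson less_trans)
  qed
qed

theorem theoremC: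
  fixes f :: "'a::compact_metric_space \<Rightarrow> 'a"
  assumes "continuous_on UNIV f"
    and "\<forall>x. statistically_unstable_point f x"
  shows "baire_generic {x. non_statistical f x}"
proof -
  define controls where "controls l \<Phi> \<delta> \<longleftrightarrow>
      finite \<Phi> \<and> (\<forall>\<phi>\<in>\<Phi>. continuous_on UNIV \<phi>) \<and> \<delta> > 0 \<and>
      (\<forall>h g y z n m. n > 0 \<longrightarrow> m > 0 \<longrightarrow>
         (\<forall>\<phi>\<in>\<Phi>. \<bar>birkhoff_average \<phi> h n y - birkhoff_average \<phi> g m z\<bar> < \<delta>) \<longrightarrow>
         wasserstein (empirical_measure h n y) (empirical_measure g m z) \<le> inverse (real (Suc l)))"
    for l and \<Phi> :: "('a pointed \<Rightarrow> real) set" and \<delta> :: real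
  have "\<exists>\<Phi> \<delta>. controls l \<Phi> \<delta>" for l
  proof -
    have "inverse (real (Suc l)) > 0"
      by simp
    from finitely_many_functions_control_wasserstein[OF this, where 'b = "'a pointed"]
    obtain \<Phi> :: "('a pointed \<Rightarrow> real) set" and \<delta> where "finite \<Phi>"
      "\<And>\<phi>. \<phi> \<in> \<Phi> \<Longrightarrow> continuous_on UNIV \<phi>" "\<delta> > 0"
      "\<And>h g y z n m. \<lbrakk>n > 0; m > 0;
         \<And>\<phi>. \<phi> \<in> \<Phi> \<Longrightarrow> \<bar>birkhoff_average \<phi> h n y - birkhoff_average \<phi> g m z\<bar> < \<delta>\<rbrakk>
       \<Longrightarrow> wasserstein (empirical_measure h n y) (empirical_measure g m z) \<le> inverse (real (Suc l))"
      by blast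
    then have "controls l \<Phi> \<delta>"
      unfolding controls_def by blast
    then show ?thesis
      by blast
  qed
  then obtain \<Phi> \<delta> where controls: "\<And>l. controls l (\<Phi> l) (\<delta> l)"
    by metis
  have fin: "finite (\<Phi> l)" and cont: "\<And>\<phi>. \<phi> \<in> \<Phi> l \<Longrightarrow> continuous_on UNIV \<phi>" and \<delta>: "\<delta> l > 0" for l
    using controls[of l] by (auto simp: controls_def)
  \<comment> \<open>The orbit of the added point is the orbit of \<open>u\<close> with one point prepended.\<close>
  define T where "T \<phi> n u = birkhoff_average \<phi> (pointed_map f u) n Added" for \<phi> n u
  have "baire_generic {x. \<exists>\<phi>\<in>(\<Union>l. \<Phi> l). \<not> convergent (\<lambda>n. T \<phi> n x)}"
  proof (rule oscillation_imp_generic_divergence)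
    show "countable (\<Union>l. \<Phi> l)"
      using fin by (simp add: countable_finite)
    show "continuous_on UNIV (T \<phi> n)" if "\<phi> \<in> (\<Union>l. \<Phi> l)" for \<phi> n
      unfolding T_def
      using that cont by (intro continuous_on_birkhoff_average_pointed_map assms(1)) auto
    fix x
    obtain l where l: "\<And>N V. open V \<Longrightarrow> x \<in> V \<Longrightarrow> \<exists>u\<in>V. \<exists>v\<in>V. \<exists>n\<ge>N. \<exists>m\<ge>N.
      inverse (real (Suc l)) < wasserstein (empirical_measure (pointed_map f u) n Added)
        (empirical_measure (pointed_map f v) m Added)"
      using statistically_unstable_point_imp_wasserstein_oscillation[OF spec[OF assms(2)], of x]
      by blast
    \<comment> \<open>Instability yields, for every \<open>N\<close> and \<open>V\<close>, some test function that tells two empirical measures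
      apart.  As there are finitely many of them, one works for all \<open>N\<close> and \<open>V\<close>.\<close>
    have "\<exists>\<phi>\<in>\<Phi> l. \<forall>N V. open V \<longrightarrow> x \<in> V \<longrightarrow>
        (\<exists>u\<in>V. \<exists>v\<in>V. \<exists>n\<ge>N. \<exists>m\<ge>N. \<delta> l \<le> dist (T \<phi> n u) (T \<phi> m v))"
    proof (rule ccontr)
      assume neg: "\<not> ?thesis"
      define calm where "calm \<phi> N V \<longleftrightarrow> open V \<and> x \<in> V \<and>
        (\<forall>u\<in>V. \<forall>v\<in>V. \<forall>n\<ge>N. \<forall>m\<ge>N. dist (T \<phi> n u) (T \<phi> m v) < \<delta> l)" for \<phi> N V
      have "\<exists>N V. calm \<phi> N V" if "\<phi> \<in> \<Phi> l" for \<phi>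
      proof (rule ccontr)
        assume "\<nexists>N V. calm \<phi> N V"
        then have "\<forall>N V. open V \<longrightarrow> x \<in> V \<longrightarrow>
            (\<exists>u\<in>V. \<exists>v\<in>V. \<exists>n\<ge>N. \<exists>m\<ge>N. \<delta> l \<le> dist (T \<phi> n u) (T \<phi> m v))"
          unfolding calm_def not_less[symmetric] by simp
        with neg that show False
          by (elim notE) (rule bexI)
      qed
      then obtain N V where calm: "\<And>\<phi>. \<phi> \<in> \<Phi> l \<Longrightarrow> calm \<phi> (N \<phi>) (V \<phi>)"
        by metis
      define W where "W = (\<Inter>\<phi>\<in>\<Phi> l. V \<phi>)"
      \<comment> \<open>The \<open>1\<close> excludes the null measure at time \<open>0\<close>.\<close>
      define M where "M = Max (insert 1 (N ` \<Phi> l))"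
      have "open W" "x \<in> W"
        unfolding W_def using calm fin by (auto simp: calm_def intro!: open_INT)
      then obtain u v n m where uv: "u \<in> W" "v \<in> W" and nm: "n \<ge> M" "m \<ge> M"
        and far: "inverse (real (Suc l)) < wasserstein (empirical_measure (pointed_map f u) n Added)
          (empirical_measure (pointed_map f v) m Added)"
        using l[of W M] by blast
      have M: "1 \<le> M" "\<And>\<phi>. \<phi> \<in> \<Phi> l \<Longrightarrow> N \<phi> \<le> M"
        unfolding M_def using fin by (auto intro!: Max_ge)
      have "\<forall>\<phi>\<in>\<Phi> l. \<bar>birkhoff_average \<phi> (pointed_map f u) n Added
          - birkhoff_average \<phi> (pointed_map f v) m Added\<bar> < \<delta> l"
      proof
        fix \<phi> assume \<phi>: "\<phi> \<in> \<Phi> l"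
        have "dist (T \<phi> n u) (T \<phi> m v) < \<delta> l"
          using calm[OF \<phi>] uv \<phi> order_trans[OF M(2)[OF \<phi>] nm(1)] order_trans[OF M(2)[OF \<phi>] nm(2)]
          unfolding calm_def W_def by blast
        then show "\<bar>birkhoff_average \<phi> (pointed_map f u) n Added
            - birkhoff_average \<phi> (pointed_map f v) m Added\<bar> < \<delta> l"
          by (simp add: T_def dist_real_def)
      qed
      then have "wasserstein (empirical_measure (pointed_map f u) n Added)
          (empirical_measure (pointed_map f v) m Added) \<le> inverse (real (Suc l))"
        using controls[of l] nm M(1) unfolding controls_def by simp
      with far show False by simp
    qed
    then show "\<exists>\<phi>\<in>(\<Union>l. \<Phi> l). \<exists>\<delta>>0. \<forall>N V. open V \<longrightarrow> x \<in> V \<longrightarrow>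
        (\<exists>u\<in>V. \<exists>v\<in>V. \<exists>n\<ge>N. \<exists>m\<ge>N. \<delta> \<le> dist (T \<phi> n u) (T \<phi> m v))"
      using \<delta>[of l] by blast
  qed
  moreover have "{x. \<exists>\<phi>\<in>(\<Union>l. \<Phi> l). \<not> convergent (\<lambda>n. T \<phi> n x)} \<subseteq> {x. non_statistical f x}"
    unfolding T_def
    using cont not_convergent_birkhoff_average_imp_non_statistical by blast
  ultimately show ?thesis
    by (rule baire_generic_mono)
qed

end
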